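(* For every integer $n\geq 4$ and every integer $k\geq 2$, $$\varphi_k(P_n)=k\big(\varphi_k(P_{n-2})+\varphi_{k-1}(P_{n-2})\big)+\binom k2\Big((k-2)!\,S(n-2,k-2)+2(k-1)!\,S(n-2,k-1)+k!\,S(n-2,k)\Big).$$
   Context: $P_n$ is the path on $n$ vertices, and $S(m,j)$ denotes the Stirling number of the second kind. A vertex coloring of a graph $G$ (not necessarily proper) is distinguishing if the only automorphism of $G$ preserving the color of every vertex is the identity. Two colorings $c_1,c_2$ of $G$ are equivalent if there is an automorphism $\alpha$ of $G$ with $c_1(v)=c_2(\alpha(v))$ for all $v\in V(G)$. $\varphi_k(G)$ is the number of non-equivalent distinguishing colorings (equivalence classes) of $G$ with color set $\{1,\dots,k\}$ in which all $k$ colors are used; $\varphi_k(G)=0$ if $G$ has no distinguishing coloring with exactly $k$ colors. *)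

theory Defs
  imports "HOL-Library.FuncSet" "HOL-Combinatorics.Stirling"
begin

text \<open>A simple graph is given by its vertex set and its set of edges, each edge being
  an unordered pair \<open>{u, v}\<close> of distinct vertices.\<close>

record 'a graph =
  verts :: "'a set"
  edges :: "'a set set"

definition simple_graph :: "'a graph \<Rightarrow> bool" where
  "simple_graph G \<longleftrightarrow> edges G \<subseteq> {{u, v} |u v. u \<in> verts G \<and> v \<in> verts G \<and> u \<noteq> v}"

definition path_graph :: "nat \<Rightarrow> nat graph" where
  "path_graph n = \<lparr>verts = {1..n}, edges = {{i, i + 1} |i. 1 \<le> i \<and> i + 1 \<le> n}\<rparr>"

definition automorphism :: "'a graph \<Rightarrow> ('a \<Rightarrow> 'a) \<Rightarrow> bool" where
  "automorphism G \<alpha> \<longleftrightarrow>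
     bij_betw \<alpha> (verts G) (verts G) \<and>
     (\<forall>u \<in> verts G. \<forall>v \<in> verts G. {\<alpha> u, \<alpha> v} \<in> edges G \<longleftrightarrow> {u, v} \<in> edges G)"

definition distinguishing :: "'a graph \<Rightarrow> ('a \<Rightarrow> 'c) \<Rightarrow> bool" where
  "distinguishing G c \<longleftrightarrow>
     (\<forall>\<alpha>. automorphism G \<alpha> \<and> (\<forall>v \<in> verts G. c (\<alpha> v) = c v) \<longrightarrow> (\<forall>v \<in> verts G. \<alpha> v = v))"

definition equivalent_colorings :: "'a graph \<Rightarrow> ('a \<Rightarrow> 'c) \<Rightarrow> ('a \<Rightarrow> 'c) \<Rightarrow> bool" where
  "equivalent_colorings G c\<^sub>1 c\<^sub>2 \<longleftrightarrow>
     (\<exists>\<alpha>. automorphism G \<alpha> \<and> (\<forall>v \<in> verts G. c\<^sub>1 v = c\<^sub>2 (\<alpha> v)))"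

text \<open>Colorings are taken extensional (constantly \<open>undefined\<close> outside the vertex set), so
  that each coloring of the vertices is represented by exactly one HOL function.\<close>

definition distinguishing_colorings :: "nat \<Rightarrow> 'a graph \<Rightarrow> ('a \<Rightarrow> nat) set" where
  "distinguishing_colorings k G =
     {c \<in> verts G \<rightarrow>\<^sub>E {1..k}. c ` verts G = {1..k} \<and> distinguishing G c}"

definition coloring_rel :: "nat \<Rightarrow> 'a graph \<Rightarrow> (('a \<Rightarrow> nat) \<times> ('a \<Rightarrow> nat)) set" where
  "coloring_rel k G =
     {(c\<^sub>1, c\<^sub>2). c\<^sub>1 \<in> distinguishing_colorings k G \<and> c\<^sub>2 \<in> distinguishing_colorings k G \<and>
                equivalent_colorings G c\<^sub>1 c\<^sub>2}"

definition varphi :: "nat \<Rightarrow> 'a graph \<Rightarrow> nat" where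
  "varphi k G = card (distinguishing_colorings k G // coloring_rel k G)"

lemma simple_graph_path_graph: "simple_graph (path_graph n)"
  unfolding simple_graph_def path_graph_def by fastforce

lemma automorphism_id: "automorphism G (\<lambda>v. v)"
  unfolding automorphism_def by (auto simp: bij_betw_def)

lemma automorphism_comp:
  assumes "automorphism G \<alpha>" "automorphism G \<beta>"
  shows "automorphism G (\<beta> \<circ> \<alpha>)"
proof -
  have "\<forall>v \<in> verts G. \<alpha> v \<in> verts G"
    using assms(1) by (auto simp: automorphism_def dest: bij_betw_apply)
  then show ?thesis
    using assms bij_betw_trans[of \<alpha> "verts G" "verts G" \<beta> "verts G"]
    unfolding automorphism_def by simp
qed

lemma automorphism_inv:
  assumes "automorphism G \<alpha>"
  shows "automorphism G (inv_into (verts G) \<alpha>)"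
proof -
  have b: "bij_betw \<alpha> (verts G) (verts G)" using assms by (simp add: automorphism_def)
  have i: "inv_into (verts G) \<alpha> v \<in> verts G" "\<alpha> (inv_into (verts G) \<alpha> v) = v"
    if "v \<in> verts G" for v
    using that b by (auto simp: bij_betw_def inv_into_into f_inv_into_f)
  show ?thesis
    unfolding automorphism_def
    using assms i bij_betw_inv_into[OF b] unfolding automorphism_def by metis
qed

lemma equiv_coloring_rel: "equiv (distinguishing_colorings k G) (coloring_rel k G)"
proof (rule equivI)
  show "coloring_rel k G \<subseteq> distinguishing_colorings k G \<times> distinguishing_colorings k G"
    by (auto simp: coloring_rel_def)
  show "refl_on (distinguishing_colorings k G) (coloring_rel k G)"
    using automorphism_id by (fastforce simp: refl_on_def coloring_rel_def equivalent_colorings_def)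
  have "equivalent_colorings G d c" if eq: "equivalent_colorings G c d" for c d :: "'a \<Rightarrow> nat"
  proof -
    obtain \<alpha> where a: "automorphism G \<alpha>" "\<forall>v \<in> verts G. c v = d (\<alpha> v)"
      using eq unfolding equivalent_colorings_def by blast
    have "\<alpha> ` verts G = verts G" using a(1) by (simp add: automorphism_def bij_betw_def)
    then have "\<forall>v \<in> verts G. d v = c (inv_into (verts G) \<alpha> v)"
      using a(2) by (metis f_inv_into_f inv_into_into)
    then show ?thesis
      using automorphism_inv[OF a(1)] unfolding equivalent_colorings_def by blast
  qed
  then show "sym (coloring_rel k G)" by (auto simp: sym_def coloring_rel_def)
  have "equivalent_colorings G c e"
    if eq: "equivalent_colorings G c d" "equivalent_colorings G d e" for c d e :: "'a \<Rightarrow> nat"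
  proof -
    obtain \<alpha> where a: "automorphism G \<alpha>" "\<forall>v \<in> verts G. c v = d (\<alpha> v)"
      using eq(1) unfolding equivalent_colorings_def by blast
    obtain \<beta> where b: "automorphism G \<beta>" "\<forall>v \<in> verts G. d v = e (\<beta> v)"
      using eq(2) unfolding equivalent_colorings_def by blast
    have "\<forall>v \<in> verts G. \<alpha> v \<in> verts G"
      using a(1) by (auto simp: automorphism_def dest: bij_betw_apply)
    then have "\<forall>v \<in> verts G. c v = e ((\<beta> \<circ> \<alpha>) v)" using a(2) b(2) by simp
    then show ?thesis
      using automorphism_comp[OF a(1) b(1)] unfolding equivalent_colorings_def by blast
  qed
  then show "trans (coloring_rel k G)" by (fastforce simp: trans_def coloring_rel_def)
qed

end

theory Submission imports Defs begin

text \<open>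
  A path on \<open>n \<ge> 2\<close> vertices has exactly two automorphisms, the identity and the reflection
  \<open>v \<mapsto> n + 1 - v\<close>. Reading a coloring from one end of the path to the other as a word of
  length \<open>n\<close>, it is distinguishing iff the word is not a palindrome, and its equivalence
  class consists of the word and its reversal, which are different. Hence
  \<open>2 \<phi>\<^sub>k(P\<^sub>n)\<close> is the number of non-palindromic words of length \<open>n\<close> whose set of letters is
  \<open>{1..k}\<close> (lemma \<open>two_varphi_path\<close>).

  These words are counted by stripping both end letters: a word \<open>a u b\<close> is a palindrome
  iff \<open>a = b\<close> and \<open>u\<close> is one. If \<open>a = b\<close>, there are \<open>k\<close> choices for \<open>a\<close>, and \<open>u\<close> is a
  non-palindrome using either all letters or all letters but \<open>a\<close>. If \<open>a \<noteq> b\<close>, there are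
  \<open>k (k - 1)\<close> choices for \<open>(a, b)\<close>, and \<open>u\<close> is an arbitrary word that uses all letters
  except possibly \<open>a\<close> and \<open>b\<close> (lemma \<open>card_nonpalindromes_rec\<close>). The number of words of length
  \<open>m\<close> with a given set of \<open>j\<close> letters is \<open>j! S(m, j)\<close>, so halving the count gives the
  recurrence.
\<close>

section \<open>Words with a prescribed set of letters\<close>

definition words_onto :: "nat \<Rightarrow> 'a set \<Rightarrow> 'a list set" where
  "words_onto m A = {xs. length xs = m \<and> set xs = A}"

definition nonpalindromes_onto :: "nat \<Rightarrow> 'a set \<Rightarrow> 'a list set" where
  "nonpalindromes_onto m A = {xs \<in> words_onto m A. rev xs \<noteq> xs}"

lemma finite_words_onto: "finite A \<Longrightarrow> finite (words_onto m A)"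
  by (rule finite_subset[OF _ finite_lists_length_eq[of A m]]) (auto simp: words_onto_def)

lemma finite_nonpalindromes_onto: "finite A \<Longrightarrow> finite (nonpalindromes_onto m A)"
  by (simp add: nonpalindromes_onto_def finite_words_onto)

lemma words_onto_disjoint: "A \<noteq> B \<Longrightarrow> words_onto m A \<inter> words_onto m B = {}"
  by (auto simp: words_onto_def)

text \<open>The first letter \<open>a\<close> may or may not recur in the rest of the word; the resulting
  recurrence is that of the Stirling numbers, multiplied by the factorial.\<close>

lemma card_words_onto:
  assumes "finite A"
  shows "card (words_onto m A) = fact (card A) * Stirling m (card A)"
  using assms
proof (induction m arbitrary: A)
  case 0
  have "words_onto 0 A = (if A = {} then {[]} else {})"
    by (auto simp: words_onto_def)
  then show ?case
    using 0 by (cases "card A") auto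
next
  case (Suc m)
  show ?case
  proof (cases "card A")
    case 0
    then have "A = {}" using Suc.prems by simp
    then show ?thesis by (auto simp: words_onto_def)
  next
    case (Suc j)
    let ?U = "\<lambda>a. words_onto m A \<union> words_onto m (A - {a})"
    have split: "words_onto (Suc m) A = (\<lambda>(a, u). a # u) ` (SIGMA a:A. ?U a)"
    proof (intro equalityI subsetI)
      fix xs assume "xs \<in> words_onto (Suc m) A"
      then obtain a u where "xs = a # u" "length u = m" "insert a (set u) = A"
        by (auto simp: words_onto_def length_Suc_conv)
      then show "xs \<in> (\<lambda>(a, u). a # u) ` (SIGMA a:A. ?U a)"
        by (intro image_eqI[of _ _ "(a, u)"]) (auto simp: words_onto_def)
    next
      fix xs assume "xs \<in> (\<lambda>(a, u). a # u) ` (SIGMA a:A. ?U a)"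
      then obtain a u where "xs = a # u" "a \<in> A" "u \<in> ?U a"
        by (auto simp del: Un_iff)
      then show "xs \<in> words_onto (Suc m) A"
        by (auto simp: words_onto_def)
    qed
    have "card (?U a) = fact (Suc j) * Stirling m (Suc j) + fact j * Stirling m j"
      if "a \<in> A" for a
    proof -
      have "A \<noteq> A - {a}" using that by blast
      then have "card (?U a) = card (words_onto m A) + card (words_onto m (A - {a}))"
        using Suc.prems by (intro card_Un_disjoint finite_words_onto words_onto_disjoint) auto
      then show ?thesis
        using Suc.IH Suc.prems Suc that by simp
    qed
    then have "card (SIGMA a:A. ?U a)
        = Suc j * (fact (Suc j) * Stirling m (Suc j) + fact j * Stirling m j)"
      using Suc.prems Suc by (subst card_SigmaI) (auto simp: finite_words_onto)
    then have "card (words_onto (Suc m) A)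
        = Suc j * (fact (Suc j) * Stirling m (Suc j) + fact j * Stirling m j)"
      unfolding split by (subst card_image) (auto simp: inj_on_def)
    then show ?thesis by (simp add: Suc algebra_simps)
  qed
qed

text \<open>Renaming the letters injectively preserves being a palindrome or not. So the count
  depends on the alphabet only through its size, which allows removing an arbitrary letter
  from \<open>{1..k}\<close> and still counting over \<open>{1..k - 1}\<close>.\<close>

lemma card_nonpalindromes_le:
  assumes "finite A" "finite B" "card A = card B"
  shows "card (nonpalindromes_onto m A) \<le> card (nonpalindromes_onto m B)"
proof -
  obtain f where f: "bij_betw f A B"
    using assms finite_same_card_bij by blast
  then have inj: "inj_on f A" and img: "f ` A = B"
    by (auto simp: bij_betw_def)
  have eq_iff: "map f xs = map f ys \<longleftrightarrow> xs = ys" if "set xs = A" "set ys = A" for xs ys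
    using inj inj_on_map_eq_map[of f xs ys] that by simp
  show ?thesis
  proof (rule card_inj_on_le)
    show "inj_on (map f) (nonpalindromes_onto m A)"
      by (auto simp: inj_on_def nonpalindromes_onto_def words_onto_def eq_iff)
    show "map f ` nonpalindromes_onto m A \<subseteq> nonpalindromes_onto m B"
      using img
      by (auto simp: nonpalindromes_onto_def words_onto_def rev_map eq_iff)
    show "finite (nonpalindromes_onto m B)"
      using assms(2) by (rule finite_nonpalindromes_onto)
  qed
qed

lemma card_nonpalindromes_cong:
  assumes "finite A" "finite B" "card A = card B"
  shows "card (nonpalindromes_onto m A) = card (nonpalindromes_onto m B)"
  using card_nonpalindromes_le assms by (metis order_antisym)

text \<open>Two letters \<open>a\<close>, \<open>b\<close> are added to the letter set \<open>S\<close> of a middle part: \<open>A\<close> results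
  exactly when \<open>S\<close> is \<open>A\<close> with some of them removed.\<close>

lemma insert2_eq_iff:
  "insert a (insert b S) = A \<longleftrightarrow>
     a \<in> A \<and> b \<in> A \<and> (S = A \<or> S = A - {a} \<or> S = A - {b} \<or> S = A - {a, b})"
proof
  assume "insert a (insert b S) = A"
  then show "a \<in> A \<and> b \<in> A \<and> (S = A \<or> S = A - {a} \<or> S = A - {b} \<or> S = A - {a, b})"
    by (cases "a \<in> S"; cases "b \<in> S") auto
qed auto

section \<open>Stripping the end letters\<close>

lemma sum_diagonal_split:
  fixes p q :: nat
  assumes "finite A"
  shows "(\<Sum>(a, b)\<in>A \<times> A. if a = b then p else q) = card A * p + card A * (card A - 1) * q"
proof -
  have "(\<Sum>b\<in>A. if a = b then p else q) = p + (card A - 1) * q" if "a \<in> A" for a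
  proof -
    have "(\<Sum>b\<in>A. if a = b then p else q) = p + (\<Sum>b\<in>A - {a}. if a = b then p else q)"
      using assms that by (simp add: sum.remove[of A a])
    also have "(\<Sum>b\<in>A - {a}. if a = b then p else q) = (\<Sum>b\<in>A - {a}. q)"
      by (rule sum.cong) auto
    finally show ?thesis using assms that by simp
  qed
  then have "(\<Sum>a\<in>A. \<Sum>b\<in>A. if a = b then p else q) = card A * (p + (card A - 1) * q)"
    by simp
  then show ?thesis
    by (simp add: sum.cartesian_product algebra_simps)
qed

text \<open>The middle parts \<open>u\<close> for which \<open>a u b\<close> is a non-palindrome with letter set \<open>A\<close>.\<close>

definition middles :: "nat \<Rightarrow> 'a set \<Rightarrow> 'a \<Rightarrow> 'a \<Rightarrow> 'a list set" where
  "middles m A a b =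
     (if a = b then nonpalindromes_onto m A \<union> nonpalindromes_onto m (A - {a})
      else (words_onto m A \<union> words_onto m (A - {a}))
           \<union> (words_onto m (A - {b}) \<union> words_onto m (A - {a, b})))"

lemma finite_middles: "finite A \<Longrightarrow> finite (middles m A a b)"
  by (simp add: middles_def finite_words_onto finite_nonpalindromes_onto)

lemma nonpalindrome_ends_iff:
  "a # u @ [b] \<in> nonpalindromes_onto (m + 2) A \<longleftrightarrow> a \<in> A \<and> b \<in> A \<and> u \<in> middles m A a b"
  using insert2_eq_iff[of a b "set u" A]
  by (auto simp: middles_def nonpalindromes_onto_def words_onto_def)

lemma card_middles:
  assumes "finite A" "a \<in> A" "b \<in> A" "card A = k"
  shows "card (middles m A a b) =
    (if a = b
     then card (nonpalindromes_onto m A) + card (nonpalindromes_onto m (A - {a}))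
     else fact k * Stirling m k + 2 * (fact (k - 1) * Stirling m (k - 1))
          + fact (k - 2) * Stirling m (k - 2))"
proof (cases "a = b")
  case True
  have "nonpalindromes_onto m A \<inter> nonpalindromes_onto m (A - {a}) = {}"
    using assms(2) by (auto simp: nonpalindromes_onto_def words_onto_def)
  then have "card (nonpalindromes_onto m A \<union> nonpalindromes_onto m (A - {a}))
      = card (nonpalindromes_onto m A) + card (nonpalindromes_onto m (A - {a}))"
    using assms(1) by (intro card_Un_disjoint finite_nonpalindromes_onto) auto
  then show ?thesis using True by (simp add: middles_def)
next
  case False
  have 1: "card (words_onto m A \<union> words_onto m (A - {a}))
      = card (words_onto m A) + card (words_onto m (A - {a}))"
    using assms by (intro card_Un_disjoint finite_words_onto words_onto_disjoint) auto
  have 2: "card (words_onto m (A - {b}) \<union> words_onto m (A - {a, b}))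
      = card (words_onto m (A - {b})) + card (words_onto m (A - {a, b}))"
    using assms False by (intro card_Un_disjoint finite_words_onto words_onto_disjoint) auto
  have ne: "A \<noteq> A - {b}" "A \<noteq> A - {a, b}" "A - {a} \<noteq> A - {b}" "A - {a} \<noteq> A - {a, b}"
    using assms False by blast+
  have "(words_onto m A \<union> words_onto m (A - {a}))
      \<inter> (words_onto m (A - {b}) \<union> words_onto m (A - {a, b})) = {}"
    using ne[THEN words_onto_disjoint, of m] by blast
  then have "card (middles m A a b)
      = card (words_onto m A \<union> words_onto m (A - {a}))
        + card (words_onto m (A - {b}) \<union> words_onto m (A - {a, b}))"
    using assms(1) False unfolding middles_def
    by (simp add: card_Un_disjoint finite_words_onto)
  moreover have "card (A - {a}) = k - 1" "card (A - {b}) = k - 1"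
    using assms by simp_all
  moreover have "card (A - {a, b}) = k - 2"
    using assms False by (simp add: card_Diff_subset)
  ultimately show ?thesis
    using assms(1,4) False by (simp add: 1 2 card_words_onto)
qed

lemma card_nonpalindromes_rec:
  "card (nonpalindromes_onto (m + 2) {1..k}) =
     k * (card (nonpalindromes_onto m {1..k}) + card (nonpalindromes_onto m {1..k - 1}))
     + k * (k - 1) * (fact k * Stirling m k + 2 * (fact (k - 1) * Stirling m (k - 1))
                      + fact (k - 2) * Stirling m (k - 2))"
    (is "_ = k * ?p + k * (k - 1) * ?q")
proof -
  \<comment> \<open>The words correspond to the pairs of end letters together with an admissible middle.\<close>
  let ?A = "{1..k}"
  let ?S = "SIGMA ab:?A \<times> ?A. middles m ?A (fst ab) (snd ab)"
  let ?f = "\<lambda>((a, b), u). a # u @ [b]"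
  have "nonpalindromes_onto (m + 2) ?A = ?f ` ?S"
  proof (intro equalityI subsetI)
    fix xs assume xs: "xs \<in> nonpalindromes_onto (m + 2) ?A"
    then obtain a ys where ys: "xs = a # ys" "length ys = Suc m"
      by (auto simp: nonpalindromes_onto_def words_onto_def length_Suc_conv)
    moreover obtain u b where "ys = u @ [b]"
      using ys(2) by (cases ys rule: rev_cases) auto
    ultimately have "xs = a # u @ [b]" by simp
    with xs show "xs \<in> ?f ` ?S"
      using nonpalindrome_ends_iff[of a u b m ?A]
      by (intro image_eqI[of _ _ "((a, b), u)"]) auto
  next
    fix xs assume "xs \<in> ?f ` ?S"
    then obtain a b u where "xs = a # u @ [b]" "a \<in> ?A" "b \<in> ?A" "u \<in> middles m ?A a b"
      by auto
    then show "xs \<in> nonpalindromes_onto (m + 2) ?A"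
      using nonpalindrome_ends_iff[of a u b m ?A] by blast
  qed
  moreover have "inj_on ?f ?S"
    by (auto simp: inj_on_def)
  ultimately have "card (nonpalindromes_onto (m + 2) ?A) = card ?S"
    by (simp add: card_image)
  also have "\<dots> = (\<Sum>ab\<in>?A \<times> ?A. card (middles m ?A (fst ab) (snd ab)))"
    by (rule card_SigmaI) (auto simp: finite_middles)
  also have "\<dots> = (\<Sum>(a, b)\<in>?A \<times> ?A. if a = b then ?p else ?q)"
  proof (rule sum.cong)
    fix ab assume "ab \<in> ?A \<times> ?A"
    then obtain a b where ab: "ab = (a, b)" "a \<in> ?A" "b \<in> ?A" by blast
    have "card (nonpalindromes_onto m (?A - {a})) = card (nonpalindromes_onto m {1..k - 1})"
      using ab by (intro card_nonpalindromes_cong) auto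
    then show "card (middles m ?A (fst ab) (snd ab))
        = (case ab of (a, b) \<Rightarrow> if a = b then ?p else ?q)"
      using ab card_middles[of ?A a b k m] by (auto simp del: One_nat_def)
  qed simp
  also have "\<dots> = k * ?p + k * (k - 1) * ?q"
    using sum_diagonal_split[of ?A ?p ?q] by simp
  finally show ?thesis .
qed

section \<open>Automorphisms of a path\<close>

lemma verts_path [simp]: "verts (path_graph n) = {1..n}"
  by (simp add: path_graph_def)

lemma edge_path_iff:
  assumes "u \<in> {1..n}" "v \<in> {1..n}"
  shows "{u, v} \<in> edges (path_graph n) \<longleftrightarrow> v = u + 1 \<or> u = v + 1"
proof
  assume "{u, v} \<in> edges (path_graph n)"
  then obtain i where "{u, v} = {i, i + 1}" by (auto simp: path_graph_def)
  then show "v = u + 1 \<or> u = v + 1" by (auto simp: doubleton_eq_iff)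
next
  assume "v = u + 1 \<or> u = v + 1"
  then show "{u, v} \<in> edges (path_graph n)"
  proof
    assume "v = u + 1"
    with assms show ?thesis unfolding path_graph_def by simp blast
  next
    assume "u = v + 1"
    with assms show ?thesis
      unfolding path_graph_def by (simp add: insert_commute[of "Suc v" v]) blast
  qed
qed

lemma bij_betw_reflection: "bij_betw (\<lambda>v. n + 1 - v) {1..n} {1..n :: nat}"
proof -
  have inv: "\<forall>v\<in>{1..n}. n + 1 - (n + 1 - v) = v" by simp
  have img: "(\<lambda>v. n + 1 - v) ` {1..n} \<subseteq> {1..n}" by (intro image_subsetI) auto
  from inv inv img img show ?thesis by (rule bij_betw_byWitness)
qed

lemma automorphism_reflection: "automorphism (path_graph n) (\<lambda>v. n + 1 - v)"
  unfolding automorphism_def verts_path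
proof (intro conjI ballI bij_betw_reflection)
  fix u v assume uv: "u \<in> {1..n}" "v \<in> {1..n}"
  then have "n + 1 - u \<in> {1..n}" "n + 1 - v \<in> {1..n}" by auto
  moreover have "n + 1 - v = n + 1 - u + 1 \<or> n + 1 - u = n + 1 - v + 1 \<longleftrightarrow> v = u + 1 \<or> u = v + 1"
    using uv unfolding atLeastAtMost_iff by linarith
  ultimately show "{n + 1 - u, n + 1 - v} \<in> edges (path_graph n) \<longleftrightarrow> {u, v} \<in> edges (path_graph n)"
    using uv by (simp only: edge_path_iff)
qed

text \<open>Consecutive vertices go to vertices at distance one, and injectivity forbids turning
  back. So the automorphism walks in one direction with unit steps, and there is room for
  \<open>n\<close> vertices only if it starts at an end of the path.\<close>

lemma automorphism_path_cases:
  assumes "automorphism (path_graph n) \<alpha>"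
  shows "(\<forall>v\<in>{1..n}. \<alpha> v = v) \<or> (\<forall>v\<in>{1..n}. \<alpha> v = n + 1 - v)"
proof (cases "n \<le> 1")
  case True
  have "\<alpha> ` {1..n} = {1..n}"
    using assms by (simp add: automorphism_def bij_betw_def)
  then show ?thesis using True by (cases n) auto
next
  case False
  have bij: "bij_betw \<alpha> {1..n} {1..n}"
    using assms by (simp add: automorphism_def)
  have range: "1 \<le> \<alpha> v" "\<alpha> v \<le> n" if "1 \<le> v" "v \<le> n" for v
    using bij_betw_apply[OF bij, of v] that by auto
  have step: "\<alpha> (v + 1) = \<alpha> v + 1 \<or> \<alpha> v = \<alpha> (v + 1) + 1" if "1 \<le> v" "v + 1 \<le> n" for v
  proof -
    have "{\<alpha> v, \<alpha> (v + 1)} \<in> edges (path_graph n) \<longleftrightarrow> {v, v + 1} \<in> edges (path_graph n)"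
      using assms that by (simp add: automorphism_def)
    then show ?thesis
      using that range[of v] range[of "v + 1"] by (simp add: edge_path_iff)
  qed
  define d where "d = int (\<alpha> 2) - int (\<alpha> 1)"
  have d: "d = 1 \<or> d = - 1"
    using step[of 1] False by (auto simp: d_def numeral_2_eq_2)
  \<comment> \<open>A change of direction after vertex \<open>i + 2\<close> would give \<open>i + 3\<close> and \<open>i + 1\<close> the same image.\<close>
  have dir: "int (\<alpha> (i + 2)) - int (\<alpha> (i + 1)) = d" if "i + 2 \<le> n" for i
    using that
  proof (induction i)
    case 0
    then show ?case by (simp add: d_def numeral_2_eq_2)
  next
    case (Suc i)
    have "\<alpha> (i + 3) \<noteq> \<alpha> (i + 1)"
      using inj_on_eq_iff[OF bij_betw_imp_inj_on[OF bij], of "i + 3" "i + 1"] Suc.prems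
      by simp
    moreover have "int (\<alpha> (i + 2)) - int (\<alpha> (i + 1)) = d"
      using Suc by simp
    moreover have "\<alpha> (i + 3) = \<alpha> (i + 2) + 1 \<or> \<alpha> (i + 2) = \<alpha> (i + 3) + 1"
      using step[of "i + 2"] Suc.prems by (simp add: numeral_3_eq_3)
    ultimately have "int (\<alpha> (i + 3)) - int (\<alpha> (i + 2)) = d"
      using d by linarith
    then show ?case by (simp add: add.commute numeral_3_eq_3)
  qed
  have lin: "int (\<alpha> (i + 1)) = int (\<alpha> 1) + d * int i" if "i + 1 \<le> n" for i
    using that
  proof (induction i)
    case (Suc i)
    then show ?case using dir[of i] by (simp add: algebra_simps)
  qed simp
  have lin': "int (\<alpha> v) = int (\<alpha> 1) + d * (int v - 1)" if "v \<in> {1..n}" for v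
    using lin[of "v - 1"] that by (simp add: of_nat_diff)
  have ends: "int (\<alpha> n) = int (\<alpha> 1) + d * (int n - 1)"
    using lin'[of n] False by simp
  have bounds: "int (\<alpha> 1) \<ge> 1" "int (\<alpha> 1) \<le> int n"
      "int (\<alpha> n) \<ge> 1" "int (\<alpha> n) \<le> int n"
    using range[of 1] range[of n] False by simp_all
  from d show ?thesis
  proof
    assume d1: "d = 1"
    \<comment> \<open>The walk ends \<open>n - 1\<close> above its start, so it starts at the lower end.\<close>
    have start: "int (\<alpha> 1) = 1"
      using ends bounds by (simp add: d1)
    have "\<alpha> v = v" if "v \<in> {1..n}" for v
      using lin'[OF that] unfolding d1 start by simp
    then show ?thesis by blast
  next
    assume d2: "d = - 1"
    have start: "int (\<alpha> 1) = int n"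
      using ends bounds by (simp add: d2)
    have "\<alpha> v = n + 1 - v" if "v \<in> {1..n}" for v
    proof -
      have "int (\<alpha> v) = int (n + 1 - v)"
        using lin'[OF that] that unfolding d2 start by (simp add: of_nat_diff)
      then show ?thesis by (simp only: of_nat_eq_iff)
    qed
    then show ?thesis by blast
  qed
qed

section \<open>Colorings of a path as words\<close>

text \<open>Only the reflection can violate distinguishability. For \<open>n \<ge> 2\<close> it moves the
  vertex \<open>1\<close>; for \<open>n = 1\<close> it is the identity and the criterion would fail.\<close>

lemma distinguishing_path_iff:
  assumes "n \<ge> 2"
  shows "distinguishing (path_graph n) c \<longleftrightarrow> (\<exists>v\<in>{1..n}. c (n + 1 - v) \<noteq> c v)"
proof
  assume "distinguishing (path_graph n) c"
  then have "(\<forall>v\<in>{1..n}. c (n + 1 - v) = c v) \<longrightarrow> (\<forall>v\<in>{1..n}. n + 1 - v = v)"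
    using automorphism_reflection[of n] by (auto simp: distinguishing_def)
  moreover have "\<not> (\<forall>v\<in>{1..n}. n + 1 - v = v)"
    using assms by (auto intro!: bexI[of _ 1])
  ultimately show "\<exists>v\<in>{1..n}. c (n + 1 - v) \<noteq> c v" by blast
next
  assume "\<exists>v\<in>{1..n}. c (n + 1 - v) \<noteq> c v"
  then show "distinguishing (path_graph n) c"
    using automorphism_path_cases[of n] unfolding distinguishing_def verts_path by metis
qed

lemma equivalent_path_iff:
  "equivalent_colorings (path_graph n) c d \<longleftrightarrow>
     (\<forall>v\<in>{1..n}. c v = d v) \<or> (\<forall>v\<in>{1..n}. c v = d (n + 1 - v))"
proof
  assume "equivalent_colorings (path_graph n) c d"
  then obtain \<alpha> where a: "automorphism (path_graph n) \<alpha>" "\<forall>v\<in>{1..n}. c v = d (\<alpha> v)"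
    by (auto simp: equivalent_colorings_def)
  from automorphism_path_cases[OF a(1)] a(2)
  show "(\<forall>v\<in>{1..n}. c v = d v) \<or> (\<forall>v\<in>{1..n}. c v = d (n + 1 - v))"
    by fastforce
next
  assume "(\<forall>v\<in>{1..n}. c v = d v) \<or> (\<forall>v\<in>{1..n}. c v = d (n + 1 - v))"
  then show "equivalent_colorings (path_graph n) c d"
    using automorphism_id[of "path_graph n"] automorphism_reflection[of n]
    unfolding equivalent_colorings_def verts_path by blast
qed

definition word_of :: "nat \<Rightarrow> (nat \<Rightarrow> 'a) \<Rightarrow> 'a list" where
  "word_of n c = map c [1..<Suc n]"

lemma word_of_eq_iff: "word_of n c = word_of n d \<longleftrightarrow> (\<forall>v\<in>{1..n}. c v = d v)"
  by (auto simp: word_of_def)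

lemma rev_word_of: "rev (word_of n c) = word_of n (\<lambda>v. c (n + 1 - v))"
  by (rule nth_equalityI) (auto simp: word_of_def rev_nth Suc_diff_Suc simp del: upt_Suc)

lemma bij_betw_word_of:
  assumes "n \<ge> 2"
  shows "bij_betw (word_of n) (distinguishing_colorings k (path_graph n))
           (nonpalindromes_onto n {1..k})"
  unfolding bij_betw_def
proof (intro conjI equalityI subsetI)
  show "inj_on (word_of n) (distinguishing_colorings k (path_graph n))"
  proof (rule inj_onI)
    fix c d
    assume "c \<in> distinguishing_colorings k (path_graph n)"
      "d \<in> distinguishing_colorings k (path_graph n)" "word_of n c = word_of n d"
    then show "c = d"
      unfolding word_of_eq_iff
      by (intro PiE_ext[of c "{1..n}" "\<lambda>_. {1..k}" d]) (auto simp: distinguishing_colorings_def)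
  qed
next
  fix xs assume "xs \<in> word_of n ` distinguishing_colorings k (path_graph n)"
  then obtain c where xs: "xs = word_of n c" and c: "c ` {1..n} = {1..k}"
      "distinguishing (path_graph n) c"
    by (auto simp: distinguishing_colorings_def)
  have "rev xs \<noteq> xs"
    using c(2) unfolding xs rev_word_of word_of_eq_iff distinguishing_path_iff[OF assms]
    by blast
  moreover have "length xs = n" "set xs = {1..k}"
    using c(1) by (auto simp: xs word_of_def atLeastLessThanSuc_atLeastAtMost simp del: upt_Suc)
  ultimately show "xs \<in> nonpalindromes_onto n {1..k}"
    by (simp add: nonpalindromes_onto_def words_onto_def)
next
  fix xs assume "xs \<in> nonpalindromes_onto n {1..k}"
  then have xs: "length xs = n" "set xs = {1..k}" "rev xs \<noteq> xs"
    by (auto simp: nonpalindromes_onto_def words_onto_def)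
  define c where "c = restrict (\<lambda>v. xs ! (v - 1)) {1..n}"
  have w: "word_of n c = xs"
    using xs(1) by (intro nth_equalityI) (auto simp: word_of_def c_def simp del: upt_Suc)
  have img: "c ` {1..n} = {1..k}"
    using arg_cong[OF w, of set] xs(2)
    by (simp add: word_of_def atLeastLessThanSuc_atLeastAtMost del: upt_Suc)
  have "distinguishing (path_graph n) c"
    using xs(3) unfolding w[symmetric] rev_word_of word_of_eq_iff
      distinguishing_path_iff[OF assms] by blast
  moreover have "c \<in> {1..n} \<rightarrow>\<^sub>E {1..k}"
    using img by (auto simp: c_def)
  ultimately have "c \<in> distinguishing_colorings k (path_graph n)"
    using img by (simp add: distinguishing_colorings_def)
  then show "xs \<in> word_of n ` distinguishing_colorings k (path_graph n)"
    using w by blast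
qed

text \<open>The class of \<open>c\<close> consists of \<open>c\<close> and its reflection \<open>c'\<close>, which differ because \<open>c\<close> is
  distinguishing. The reflection is cut off outside \<open>{1..n}\<close> since colorings are extensional.\<close>

lemma card_coloring_class_path:
  assumes n: "n \<ge> 2" and c: "c \<in> distinguishing_colorings k (path_graph n)"
  shows "card (coloring_rel k (path_graph n) `` {c}) = 2"
proof -
  let ?D = "distinguishing_colorings k (path_graph n)"
  define c' where "c' = restrict (\<lambda>v. c (n + 1 - v)) {1..n}"
  have c1: "c \<in> {1..n} \<rightarrow>\<^sub>E {1..k}" "c ` {1..n} = {1..k}"
      "\<exists>v\<in>{1..n}. c (n + 1 - v) \<noteq> c v"
    using c distinguishing_path_iff[OF n] by (auto simp: distinguishing_colorings_def)
  have refl_img: "(\<lambda>v. n + 1 - v) ` {1..n} = {1..n}"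
    using bij_betw_reflection by (rule bij_betw_imp_surj_on)
  have c'_img: "c' ` {1..n} = {1..k}"
  proof -
    have "c' ` {1..n} = c ` (\<lambda>v. n + 1 - v) ` {1..n}"
      by (simp add: c'_def image_image)
    then show ?thesis using refl_img c1(2) by simp
  qed
  have c'_eq: "c' v = c (n + 1 - v)" "c' (n + 1 - v) = c v" if "v \<in> {1..n}" for v
    using that by (auto simp: c'_def)
  have "distinguishing (path_graph n) c'"
    unfolding distinguishing_path_iff[OF n] using c1(3) c'_eq by metis
  moreover have "c' \<in> {1..n} \<rightarrow>\<^sub>E {1..k}"
    using c'_img by (auto simp: c'_def)
  ultimately have c': "c' \<in> ?D"
    using c'_img by (simp add: distinguishing_colorings_def)
  have "c \<noteq> c'" using c1(3) c'_eq by metis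
  moreover have "coloring_rel k (path_graph n) `` {c} = {c, c'}"
  proof (intro equalityI subsetI)
    fix d assume "d \<in> coloring_rel k (path_graph n) `` {c}"
    then have d: "d \<in> ?D" and "equivalent_colorings (path_graph n) c d"
      by (auto simp: coloring_rel_def)
    then have disj: "(\<forall>v\<in>{1..n}. c v = d v) \<or> (\<forall>v\<in>{1..n}. c v = d (n + 1 - v))"
      by (simp add: equivalent_path_iff)
    have dE: "d \<in> {1..n} \<rightarrow>\<^sub>E {1..k}"
      using d by (simp add: distinguishing_colorings_def)
    from disj show "d \<in> {c, c'}"
    proof
      assume "\<forall>v\<in>{1..n}. c v = d v"
      then have "c = d" by (intro PiE_ext[OF c1(1) dE]) auto
      then show ?thesis by simp
    next
      assume rev_eq: "\<forall>v\<in>{1..n}. c v = d (n + 1 - v)"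
      have "d v = c' v" if "v \<in> {1..n}" for v
      proof -
        have "n + 1 - v \<in> {1..n}" "n + 1 - (n + 1 - v) = v" using that by auto
        then show ?thesis using rev_eq c'_eq(1)[OF that] by metis
      qed
      then have "d = c'" by (intro PiE_ext[OF dE \<open>c' \<in> {1..n} \<rightarrow>\<^sub>E {1..k}\<close>]) auto
      then show ?thesis by simp
    qed
  next
    fix d assume "d \<in> {c, c'}"
    then have "d \<in> ?D" and "equivalent_colorings (path_graph n) c d"
      using c c' c'_eq by (auto simp: equivalent_path_iff)
    then show "d \<in> coloring_rel k (path_graph n) `` {c}"
      using c by (simp add: coloring_rel_def)
  qed
  ultimately show ?thesis by simp
qed

text \<open>All classes have size two, so there are twice as many distinguishing colorings as
  classes, and the colorings correspond to the non-palindromic words.\<close>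

lemma two_varphi_path:
  assumes "n \<ge> 2"
  shows "2 * varphi k (path_graph n) = card (nonpalindromes_onto n {1..k})"
proof -
  let ?D = "distinguishing_colorings k (path_graph n)"
  let ?R = "coloring_rel k (path_graph n)"
  have bij: "bij_betw (word_of n) ?D (nonpalindromes_onto n {1..k})"
    using assms by (rule bij_betw_word_of)
  have fin: "finite ?D"
    using bij_betw_finite[OF bij] by (simp add: finite_nonpalindromes_onto)
  have eq: "equiv ?D ?R" by (rule equiv_coloring_rel)
  have "2 * card (?D // ?R) = card (\<Union> (?D // ?R))"
  proof (rule card_partition)
    show "finite (?D // ?R)"
      using fin equiv_type[OF eq] by (rule finite_quotient)
    show "finite (\<Union> (?D // ?R))"
      using fin by (simp add: Union_quotient[OF eq])
    show "card X = 2" if "X \<in> ?D // ?R" for X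
      using that card_coloring_class_path[OF assms] by (auto simp: quotient_def)
    show "X \<inter> Y = {}" if "X \<in> ?D // ?R" "Y \<in> ?D // ?R" "X \<noteq> Y" for X Y
      using quotient_disj[OF eq that(1,2)] that(3) by blast
  qed
  then show ?thesis
    using bij_betw_same_card[OF bij] by (simp add: varphi_def Union_quotient[OF eq])
qed

section \<open>The recurrence\<close>

text \<open>The bound \<open>n \<ge> 4\<close> makes the shorter path \<open>P\<^sub>n\<^sub>-\<^sub>2\<close> long enough for its reflection to
  be a non-trivial automorphism, so that \<open>\<phi>\<close> is half the number of non-palindromes there, too.
  All summands of the count of words are even: the ordered pairs of distinct end letters
  number \<open>k (k - 1)\<close>, twice the binomial coefficient \<open>k choose 2\<close>.\<close>

theorem theorem2p2:
  fixes n k :: nat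
  assumes "n \<ge> 4" and "k \<ge> 2"
  shows "varphi k (path_graph n) =
           k * (varphi k (path_graph (n - 2)) + varphi (k - 1) (path_graph (n - 2)))
           + (k choose 2) * (fact (k - 2) * Stirling (n - 2) (k - 2)
                             + 2 * fact (k - 1) * Stirling (n - 2) (k - 1)
                             + fact k * Stirling (n - 2) k)"
proof -
  define m where "m = n - 2"
  have m: "n = m + 2" "m \<ge> 2" using assms(1) by (auto simp: m_def)
  have pairs: "k * (k - 1) = 2 * (k choose 2)"
    by (cases k) (simp_all add: choose_two)
  have "2 * varphi k (path_graph (m + 2)) =
      k * (2 * varphi k (path_graph m) + 2 * varphi (k - 1) (path_graph m))
      + 2 * (k choose 2) * (fact k * Stirling m k + 2 * (fact (k - 1) * Stirling m (k - 1))
                            + fact (k - 2) * Stirling m (k - 2))"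
    using m(2) card_nonpalindromes_rec[of m k]
    by (simp only: two_varphi_path pairs le_add2)
  then show ?thesis
    by (simp add: m(1) algebra_simps)
qed

end
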